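(* Let $k\geq\ell\geq 1$ be integers. Then $$C(C_{2k+1},C_{2\ell+1})\geq\frac{4k^2-1}{4k\ell-1}.$$
   Context: All graphs are finite and simple. $C_m$ denotes the cycle on $m$ vertices. $\operatorname{hom}(H,T)$ is the number of maps $V(H)\to V(T)$ sending every edge of $H$ to an edge of $T$, $t(H,T)=\operatorname{hom}(H,T)/v(T)^{v(H)}$, and $C(G,H)=\min\{c\in\mathbb{R}: t(G,T)\geq t(H,T)^c \text{ for all graphs } T\}$. *)

theory Defs
  imports
    Complex_Main
    "HOL-Library.FuncSet"
    "Graph_Theory.Pair_Digraph"
begin

text \<open>
  A finite simple graph is a \<^term>\<open>pair_graph\<close>: finite vertex set, and a symmetric
  irreflexive arc relation, so that an edge is represented by its two orientations.
\<close>

definition graph_homs :: "'a pair_pre_digraph \<Rightarrow> 'b pair_pre_digraph \<Rightarrow> ('a \<Rightarrow> 'b) set" where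
  "graph_homs H T =
     {f \<in> pverts H \<rightarrow>\<^sub>E pverts T. \<forall>u v. (u, v) \<in> parcs H \<longrightarrow> (f u, f v) \<in> parcs T}"

definition hom_count :: "'a pair_pre_digraph \<Rightarrow> 'b pair_pre_digraph \<Rightarrow> nat" where
  "hom_count H T = card (graph_homs H T)"

definition hom_density :: "'a pair_pre_digraph \<Rightarrow> 'b pair_pre_digraph \<Rightarrow> real" where
  "hom_density H T = real (hom_count H T) / real (card (pverts T)) ^ card (pverts H)"

text \<open>
  Targets range over the graphs with vertices in \<^typ>\<open>nat\<close>, which represent every finite graph
  up to isomorphism; the null graph, for which the density is not defined, is excluded.
  \<open>LEAST\<close> on \<^typ>\<open>real\<close> is the minimum when it is attained and is unspecified otherwise.
  The library's \<open>0 powr c = 0\<close> for \<open>c \<le> 0\<close> does not affect the minimum: if \<open>H\<close> has no edge then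
  its density is always \<open>1\<close>, and if \<open>H\<close> has an edge then no \<open>c < 0\<close> is admissible, and \<open>c = 0\<close>
  only if \<open>G\<close> has no edge, that is, if its density is always \<open>1\<close>.
\<close>

definition domination_exponent :: "'a pair_pre_digraph \<Rightarrow> 'b pair_pre_digraph \<Rightarrow> real" where
  "domination_exponent G H =
     (LEAST c. \<forall>T :: nat pair_pre_digraph. pair_graph T \<and> pverts T \<noteq> {} \<longrightarrow>
        hom_density G T \<ge> hom_density H T powr c)"

definition cycle_graph :: "nat \<Rightarrow> nat pair_pre_digraph" where
  "cycle_graph m =
     \<lparr> pverts = {..<m},
       parcs = {(i, j). i < m \<and> j < m \<and> (j = Suc i mod m \<or> i = Suc j mod m)} \<rparr>"

lemma pair_graph_cycle_graph:
  assumes "m \<ge> 3"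
  shows "pair_graph (cycle_graph m)"
proof
  have "parcs (cycle_graph m) \<subseteq> {..<m} \<times> {..<m}"
    by (auto simp: cycle_graph_def)
  then show "finite (parcs (cycle_graph m))"
    by (rule finite_subset) simp
  show "symmetric (with_proj (cycle_graph m))"
    by (auto simp: symmetric_def sym_def cycle_graph_def)
  show "fst e \<noteq> snd e" if "e \<in> parcs (cycle_graph m)" for e
    using that assms by (auto simp: cycle_graph_def mod_Suc split: if_splits)
qed (auto simp: cycle_graph_def)

end

theory Submission
  imports
    Defs
    "HOL-Analysis.Analysis"
    "HOL-Computational_Algebra.Primes"
begin

text \<open>
  The extremal targets are the graphs on the affine plane over \<open>\<int>/p\<close> in which two points are
  adjacent iff they span a line with slope in \<open>{0..<r}\<close>. A closed walk of length \<open>m\<close> with a constant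
  slope sequence stays in one line, and there are about \<open>r p^(m+1)\<close> of these; a non-constant slope
  sequence imposes one further independent linear condition, so all other closed walks number at most
  \<open>r^m p^m\<close>. Taking \<open>r\<close> close to \<open>p^(1/(2k))\<close> balances the two contributions at \<open>m = 2k+1\<close>, so that up
  to constants the density of \<open>C_(2k+1)\<close> is at most \<open>p^(1/(2k) - 2k)\<close> while that of \<open>C_(2l+1)\<close> is at least
  \<open>p^(1/(2k) - 2l)\<close>. Letting \<open>p\<close> grow bounds every admissible exponent from below.

  The minimum defining the exponent is attained because the set of admissible exponents is closed and,
  by \<open>t(C_(m+2)) \<ge> t(C_m)^4\<close>, nonempty.
\<close>

subsection \<open>Homomorphisms from cycles\<close>

lemma pair_graph_finite_verts: "pair_graph T \<Longrightarrow> finite (pverts T)"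
  by (simp add: pair_graph_def pair_digraph_def pair_fin_digraph.pair_finite_verts)

lemma pair_graph_arcs_sym: "pair_graph T \<Longrightarrow> (u, v) \<in> parcs T \<Longrightarrow> (v, u) \<in> parcs T"
  by (auto simp: pair_graph_def pair_pseudo_graph_def pair_sym_digraph_def
      pair_sym_digraph_axioms_def symmetric_def sym_def)

text \<open>Arcs of the target are symmetric, so each cycle edge has to be checked in one
  orientation only.\<close>

lemma cycle_graph_homs_iff:
  assumes "pair_graph T" "m \<ge> 1"
  shows "f \<in> graph_homs (cycle_graph m) T \<longleftrightarrow>
    f \<in> {..<m} \<rightarrow>\<^sub>E pverts T \<and> (\<forall>i<m. (f i, f (Suc i mod m)) \<in> parcs T)"
proof -
  show ?thesis
    using assms(2) pair_graph_arcs_sym[OF assms(1)] unfolding graph_homs_def cycle_graph_def by auto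
qed

lemma finite_cycle_graph_homs:
  assumes "pair_graph T"
  shows "finite (graph_homs (cycle_graph m) T)"
proof -
  have "finite ({..<m} \<rightarrow>\<^sub>E pverts T)"
    by (intro finite_PiE pair_graph_finite_verts assms) simp
  then show ?thesis
    by (rule rev_finite_subset) (auto simp: graph_homs_def cycle_graph_def)
qed

lemma hom_density_nonneg: "0 \<le> hom_density G T"
  by (simp add: hom_density_def)

lemma hom_density_cycle_le_1:
  assumes "pair_graph T"
  shows "hom_density (cycle_graph m) T \<le> 1"
proof -
  note fin = pair_graph_finite_verts[OF assms]
  have "hom_count (cycle_graph m) T \<le> card ({..<m} \<rightarrow>\<^sub>E pverts T)"
    unfolding hom_count_def
    by (rule card_mono) (use fin in \<open>auto simp: graph_homs_def cycle_graph_def intro!: finite_PiE\<close>)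
  also have "\<dots> = card (pverts T) ^ m"
    by (simp add: card_PiE)
  finally have "real (hom_count (cycle_graph m) T) \<le> real (card (pverts T)) ^ m"
    by (simp flip: of_nat_power)
  then show ?thesis
    by (simp add: hom_density_def cycle_graph_def divide_le_eq_1_pos divide_le_eq)
qed

section \<open>Lengthening a cycle by two vertices\<close>

text \<open>Cauchy-Schwarz twice: first over the column sums of \<open>M\<close>, then over the
  codegrees \<open>K (u, y)\<close>. The four factors run around the 4-cycle u, v, y, x; one is kept
  apart from the other three, which form a path from u to v.\<close>

lemma four_cycle_weight_ge:
  fixes M :: "'a \<Rightarrow> 'a \<Rightarrow> real"
  assumes "finite V"
  shows "(\<Sum>u\<in>V. \<Sum>v\<in>V. M u v) ^ 4 \<le>
    real (card V) ^ 4 * (\<Sum>u\<in>V. \<Sum>v\<in>V. \<Sum>x\<in>V. \<Sum>y\<in>V. M u v * (M u x * M y x * M y v))"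
proof -
  let ?n = "real (card V)"
  define K where "K = (\<lambda>(u, y). \<Sum>v\<in>V. M u v * M y v)"
  have "(\<Sum>u\<in>V. \<Sum>v\<in>V. M u v)\<^sup>2 = (\<Sum>v\<in>V. \<Sum>u\<in>V. M u v)\<^sup>2"
    by (subst sum.swap) simp
  also have "\<dots> \<le> ?n * (\<Sum>v\<in>V. (\<Sum>u\<in>V. M u v)\<^sup>2)"
    using sum_squared_le_sum_of_squares[of "\<lambda>v. \<Sum>u\<in>V. M u v" V] by (simp add: mult.commute)
  also have "(\<Sum>v\<in>V. (\<Sum>u\<in>V. M u v)\<^sup>2) = (\<Sum>v\<in>V. \<Sum>u\<in>V. \<Sum>y\<in>V. M u v * M y v)"
    by (simp add: power2_eq_square sum_product)
  also have "\<dots> = (\<Sum>u\<in>V. \<Sum>v\<in>V. \<Sum>y\<in>V. M u v * M y v)"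
    by (rule sum.swap)
  also have "\<dots> = (\<Sum>u\<in>V. \<Sum>y\<in>V. \<Sum>v\<in>V. M u v * M y v)"
    by (intro sum.cong refl sum.swap)
  also have "\<dots> = sum K (V \<times> V)"
    by (simp add: K_def sum.cartesian_product')
  finally have 1: "(\<Sum>u\<in>V. \<Sum>v\<in>V. M u v)\<^sup>2 \<le> ?n * sum K (V \<times> V)" .
  have 2: "(sum K (V \<times> V))\<^sup>2 \<le> ?n\<^sup>2 * (\<Sum>z\<in>V \<times> V. (K z)\<^sup>2)"
    using sum_squared_le_sum_of_squares[of K "V \<times> V"] 
    by (simp add: card_cartesian_product power2_eq_square mult.commute)
  have "(\<Sum>z\<in>V \<times> V. (K z)\<^sup>2) = (\<Sum>u\<in>V. \<Sum>y\<in>V. \<Sum>v\<in>V. \<Sum>x\<in>V. M u v * (M u x * M y x * M y v))"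
    by (simp add: K_def sum.cartesian_product' power2_eq_square sum_product mult_ac)
  also have "\<dots> = (\<Sum>u\<in>V. \<Sum>v\<in>V. \<Sum>y\<in>V. \<Sum>x\<in>V. M u v * (M u x * M y x * M y v))"
    by (intro sum.cong refl sum.swap)
  also have "\<dots> = (\<Sum>u\<in>V. \<Sum>v\<in>V. \<Sum>x\<in>V. \<Sum>y\<in>V. M u v * (M u x * M y x * M y v))"
    by (intro sum.cong refl sum.swap)
  finally have 3: "(\<Sum>z\<in>V \<times> V. (K z)\<^sup>2) = \<dots>" .
  have "(\<Sum>u\<in>V. \<Sum>v\<in>V. M u v) ^ 4 = ((\<Sum>u\<in>V. \<Sum>v\<in>V. M u v)\<^sup>2)\<^sup>2"
    by (simp flip: power_mult)
  also have "\<dots> \<le> (?n * sum K (V \<times> V))\<^sup>2"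
    using 1 by (intro power_mono) auto
  also have "\<dots> \<le> ?n\<^sup>2 * (?n\<^sup>2 * (\<Sum>z\<in>V \<times> V. (K z)\<^sup>2))"
    unfolding power_mult_distrib using 2 by (intro mult_left_mono) auto
  also have "\<dots> = ?n ^ 4 * (\<Sum>z\<in>V \<times> V. (K z)\<^sup>2)"
    by (simp add: power2_eq_square power4_eq_xxxx)
  finally show ?thesis unfolding 3 .
qed

text \<open>
  The weight \<open>M u v\<close> in the proof is the normalised number of \<open>m\<close>-cycles through the edge \<open>uv\<close>. Since \<open>M\<close> is
  at most the edge indicator, three of its four copies in \<open>four_cycle_weight_ge\<close> bound the number of
  paths of length 3 that can replace the edge \<open>uv\<close> of such a cycle.
\<close>

lemma hom_density_cycle_add_2:
  assumes T: "pair_graph T" "pverts T \<noteq> {}" and m: "m \<ge> 2"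
  shows "hom_density (cycle_graph (m + 2)) T \<ge> hom_density (cycle_graph m) T ^ 4"
proof -
  let ?V = "pverts T" and ?E = "parcs T" and ?n = "card (pverts T)"
  let ?H = "graph_homs (cycle_graph m) T"
  note fin = pair_graph_finite_verts[OF T(1)]
  have n0: "?n > 0" using T fin by (simp add: card_gt_0_iff)
  note sym = pair_graph_arcs_sym[OF T(1)]
  have finH: "finite ?H" by (rule finite_cycle_graph_homs[OF T(1)])
  have H: "f \<in> ?H \<longleftrightarrow> f \<in> {..<m} \<rightarrow>\<^sub>E ?V \<and> (\<forall>i<m. (f i, f (Suc i mod m)) \<in> ?E)" for f
    using m by (intro cycle_graph_homs_iff T) auto
  define F where "F u v = {f \<in> ?H. (f (m - 1), f 0) = (u, v)}" for u v
  define P where "P u v = {(x, y) \<in> ?V \<times> ?V. (u, x) \<in> ?E \<and> (x, y) \<in> ?E \<and> (y, v) \<in> ?E}" for u v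
  have finP: "finite (P u v)" for u v
    unfolding P_def by (rule finite_subset[of _ "?V \<times> ?V"]) (use fin in auto)
  have group: "(\<Sum>u\<in>?V. \<Sum>v\<in>?V. \<Sum>f\<in>F u v. h f) = sum h ?H" for h :: "_ \<Rightarrow> nat"
  proof -
    have "(\<Sum>z\<in>?V \<times> ?V. \<Sum>f\<in>{f \<in> ?H. (f (m - 1), f 0) = z}. h f) = sum h ?H"
      by (rule sum.group) (use fin finH m in \<open>auto simp: H PiE_iff\<close>)
    then show ?thesis by (simp add: sum.cartesian_product' F_def)
  qed
  have hom_m: "hom_count (cycle_graph m) T = (\<Sum>u\<in>?V. \<Sum>v\<in>?V. card (F u v))"
    using group[of "\<lambda>_. 1"] by (simp add: hom_count_def)
  \<comment> \<open>Once the ends of the closing edge are fixed, only the m - 2 inner vertices are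
    free. This is what makes the normalised weight \<open>M\<close> at most 1.\<close>
  have F_le: "card (F u v) \<le> ?n ^ (m - 2)" for u v
  proof -
    have "card (F u v) \<le> card ({1..<m - 1} \<rightarrow>\<^sub>E ?V)"
    proof (rule card_inj_on_le)
      show "inj_on (\<lambda>f. restrict f {1..<m - 1}) (F u v)"
      proof (rule inj_onI)
        fix f g assume fg: "f \<in> F u v" "g \<in> F u v"
          and e: "restrict f {1..<m - 1} = restrict g {1..<m - 1}"
        show "f = g"
        proof (rule PiE_ext)
          show "f \<in> {..<m} \<rightarrow>\<^sub>E ?V" "g \<in> {..<m} \<rightarrow>\<^sub>E ?V" using fg by (auto simp: F_def H)
          fix i assume "i \<in> {..<m}"
          then consider "i = 0" | "i = m - 1" | "i \<in> {1..<m - 1}" by fastforce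
          then show "f i = g i"
            using fg fun_cong[OF e, of i] by cases (auto simp: F_def)
        qed
      qed
      show "(\<lambda>f. restrict f {1..<m - 1}) ` F u v \<subseteq> {1..<m - 1} \<rightarrow>\<^sub>E ?V"
        by (auto simp: F_def H PiE_iff split: if_splits)
    qed (use fin in \<open>auto intro!: finite_PiE\<close>)
    also have "\<dots> = ?n ^ (m - 2)" by (simp add: card_PiE numeral_2_eq_2)
    finally show ?thesis .
  qed
  \<comment> \<open>Index m receives x and index m + 1 receives y, so the path replaces the closing
    edge; the homomorphism and the path can be read off from the result.\<close>
  have ext: "(\<Sum>u\<in>?V. \<Sum>v\<in>?V. card (F u v) * card (P u v)) \<le> hom_count (cycle_graph (m + 2)) T"
  proof -
    let ?X = "SIGMA f:?H. P (f (m - 1)) (f 0)"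
    have "(\<Sum>u\<in>?V. \<Sum>v\<in>?V. card (F u v) * card (P u v)) =
        (\<Sum>u\<in>?V. \<Sum>v\<in>?V. \<Sum>f\<in>F u v. card (P (f (m - 1)) (f 0)))"
      by (intro sum.cong refl) (simp add: F_def)
    also have "\<dots> = card ?X" unfolding group using finH finP by (simp add: card_SigmaI)
    also have "\<dots> \<le> card (graph_homs (cycle_graph (m + 2)) T)"
    proof (rule card_inj_on_le)
      show "finite (graph_homs (cycle_graph (m + 2)) T)" by (rule finite_cycle_graph_homs[OF T(1)])
      let ?h = "\<lambda>(f, x, y). f(m := x, Suc m := y)"
      show "inj_on ?h ?X"
      proof (rule inj_onI)
        fix a b assume ab: "a \<in> ?X" "b \<in> ?X" "?h a = ?h b"
        obtain f x y g z w where eq: "a = (f, x, y)" "b = (g, z, w)" by (metis prod_cases3)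
        have e: "f(m := x, Suc m := y) = g(m := z, Suc m := w)" using ab(3) unfolding eq prod.case .
        have "x = z" using fun_cong[OF e, of m] by simp
        moreover have "y = w" using fun_cong[OF e, of "Suc m"] by simp
        moreover have "f = g"
        proof (rule PiE_ext)
          show "f \<in> {..<m} \<rightarrow>\<^sub>E ?V" "g \<in> {..<m} \<rightarrow>\<^sub>E ?V" using ab(1,2) by (auto simp: eq H)
          show "f i = g i" if "i \<in> {..<m}" for i using fun_cong[OF e, of i] that by simp
        qed
        ultimately show "a = b" by (simp add: eq)
      qed
      show "?h ` ?X \<subseteq> graph_homs (cycle_graph (m + 2)) T"
      proof (rule image_subsetI)
        fix a assume a: "a \<in> ?X"
        obtain f x y where eq: "a = (f, x, y)" by (metis prod_cases3)
        have f: "f \<in> {..<m} \<rightarrow>\<^sub>E ?V" "\<And>i. i < m \<Longrightarrow> (f i, f (Suc i mod m)) \<in> ?E"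
          using a by (auto simp: eq H)
        have xy: "x \<in> ?V" "y \<in> ?V" "(f (m - 1), x) \<in> ?E" "(x, y) \<in> ?E" "(y, f 0) \<in> ?E"
          using a by (auto simp: eq P_def)
        let ?g = "f(m := x, Suc m := y)"
        have "(?g i, ?g (Suc i mod (m + 2))) \<in> ?E" if "i < m + 2" for i
        proof -
          consider "Suc i < m" | "Suc i = m" | "i = m" | "i = Suc m" using \<open>i < m + 2\<close> by linarith
          then show ?thesis
          proof cases
            case 1
            then show ?thesis using f(2)[of i] by simp
          next
            case 2
            then show ?thesis using xy(3) by auto
          qed (use xy m in auto)
        qed
        moreover have "?g \<in> {..<m + 2} \<rightarrow>\<^sub>E ?V"
          using f(1) xy(1,2) by (auto simp: PiE_iff extensional_def less_Suc_eq)
        ultimately show "?h a \<in> graph_homs (cycle_graph (m + 2)) T"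
          unfolding eq prod.case using m by (subst cycle_graph_homs_iff[OF T(1)]) auto
      qed
    qed
    finally show ?thesis by (simp add: hom_count_def)
  qed
  let ?N = "real ?n"
  define M where "M u v = real (card (F u v)) / ?N ^ (m - 2)" for u v
  have M0: "M u v \<ge> 0" for u v by (simp add: M_def)
  have M1: "M u v \<le> of_bool ((u, v) \<in> ?E)" for u v
  proof (cases "(u, v) \<in> ?E")
    case True
    have "real (card (F u v)) \<le> ?N ^ (m - 2)" using F_le[of u v] by (metis of_nat_le_iff of_nat_power)
    then show ?thesis using True n0 by (simp add: M_def)
  next
    case False
    have "F u v = {}"
    proof -
      have False if "f \<in> F u v" for f
      proof -
        have "m - 1 < m" "\<forall>i<m. (f i, f (Suc i mod m)) \<in> ?E" using that m by (auto simp: F_def H)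
        then have "(f (m - 1), f (Suc (m - 1) mod m)) \<in> ?E" by blast
        then show False using that False m by (auto simp: F_def)
      qed
      then show ?thesis by blast
    qed
    then show ?thesis by (simp add: M_def)
  qed
  have P_ge: "(\<Sum>x\<in>?V. \<Sum>y\<in>?V. M u x * M y x * M y v) \<le> real (card (P u v))" for u v
  proof -
    have "(\<Sum>x\<in>?V. \<Sum>y\<in>?V. M u x * M y x * M y v) \<le>
        (\<Sum>x\<in>?V. \<Sum>y\<in>?V. of_bool ((u, x) \<in> ?E) * of_bool ((y, x) \<in> ?E) * of_bool ((y, v) \<in> ?E))"
      by (intro sum_mono mult_mono M1 M0 mult_nonneg_nonneg) auto
    \<comment> \<open>The bound on \<open>M y x\<close> is the indicator of \<open>(y, x)\<close>,
      whereas \<open>P\<close> asks for \<open>(x, y)\<close>; symmetry of the arcs reconciles the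
      two.\<close>
    also have "\<dots> = (\<Sum>z\<in>?V \<times> ?V. of_bool (z \<in> P u v))"
      unfolding sum.cartesian_product
      by (intro sum.cong refl) (use sym in \<open>auto simp: P_def\<close>)
    also have "\<dots> = real (card ((?V \<times> ?V) \<inter> P u v))"
      using fin by (simp add: Collect_mem_eq)
    also have "(?V \<times> ?V) \<inter> P u v = P u v" by (auto simp: P_def)
    finally show ?thesis .
  qed
  have Nm: "?N ^ (m - 2) > 0" using n0 by simp
  define S where "S = (\<Sum>u\<in>?V. \<Sum>v\<in>?V. M u v)"
  have S: "real (hom_count (cycle_graph m) T) = ?N ^ (m - 2) * S"
    unfolding hom_m S_def M_def sum_distrib_left using n0 by simp
  have "S ^ 4 \<le> ?N ^ 4 * (\<Sum>u\<in>?V. \<Sum>v\<in>?V. \<Sum>x\<in>?V. \<Sum>y\<in>?V. M u v * (M u x * M y x * M y v))"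
    unfolding S_def by (rule four_cycle_weight_ge[OF fin])
  also have "\<dots> \<le> ?N ^ 4 * (\<Sum>u\<in>?V. \<Sum>v\<in>?V. M u v * real (card (P u v)))"
    unfolding sum_distrib_left[of "M _ _", symmetric]
    by (intro mult_left_mono sum_mono P_ge M0) simp
  finally have "?N ^ (m - 2) * S ^ 4 \<le>
      ?N ^ (m - 2) * (?N ^ 4 * (\<Sum>u\<in>?V. \<Sum>v\<in>?V. M u v * real (card (P u v))))"
    by (intro mult_left_mono) auto
  also have "\<dots> =
      ?N ^ 4 * real (\<Sum>u\<in>?V. \<Sum>v\<in>?V. card (F u v) * card (P u v))"
    unfolding M_def sum_distrib_left of_nat_sum using n0 by (intro sum.cong refl) simp
  also have "\<dots> \<le> ?N ^ 4 * real (hom_count (cycle_graph (m + 2)) T)"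
    using ext by (intro mult_left_mono) (simp_all only: of_nat_le_iff, simp)
  finally have main: "?N ^ (m - 2) * S ^ 4 \<le> ?N ^ 4 * real (hom_count (cycle_graph (m + 2)) T)" .
  \<comment> \<open>With m = j + 2 the density of the m-cycle becomes S / N^2, so its fourth power
    is S^4 / N^8.\<close>
  define j where "j = m - 2"
  have mj: "m = j + 2" using m by (simp add: j_def)
  have "hom_density (cycle_graph m) T = ?N ^ j * S / ?N ^ (j + 2)"
    unfolding hom_density_def S by (simp add: cycle_graph_def mj)
  also have "\<dots> = S / ?N ^ 2" using n0 by (simp add: power_add power2_eq_square)
  finally have "hom_density (cycle_graph m) T ^ 4 = S ^ 4 / ?N ^ 8"
    by (simp add: power_divide flip: power_mult)
  also have "\<dots> = ?N ^ j * S ^ 4 / (?N ^ j * ?N ^ 8)" using n0 by simp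
  also have "\<dots> = ?N ^ (m - 2) * S ^ 4 / ?N ^ (m + 6)" unfolding mj by (simp add: add.commute flip: power_add)
  also have "\<dots> \<le> ?N ^ 4 * real (hom_count (cycle_graph (m + 2)) T) / ?N ^ (m + 6)"
    using main by (intro divide_right_mono) auto
  also have "?N ^ (m + 6) = ?N ^ 4 * ?N ^ (m + 2)"
    unfolding power_add[symmetric] by (rule arg_cong[of _ _ "power ?N"]) simp
  also have "?N ^ 4 * real (hom_count (cycle_graph (m + 2)) T) / (?N ^ 4 * ?N ^ (m + 2)) =
      hom_density (cycle_graph (m + 2)) T"
    unfolding hom_density_def using n0 by (simp add: cycle_graph_def)
  finally show ?thesis .
qed

text \<open>Iterating the previous step supplies an admissible exponent, so that the set whose
  minimum is taken is nonempty.\<close>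

lemma hom_density_cycle_add:
  assumes T: "pair_graph T" "pverts T \<noteq> {}" and m: "m \<ge> 2"
  shows "hom_density (cycle_graph (m + 2 * j)) T \<ge> hom_density (cycle_graph m) T ^ (4 ^ j)"
proof (induction j)
  case (Suc j)
  have "hom_density (cycle_graph m) T ^ (4 ^ Suc j) = (hom_density (cycle_graph m) T ^ (4 ^ j)) ^ 4"
    by (simp add: power_mult[symmetric] mult.commute)
  also have "\<dots> \<le> hom_density (cycle_graph (m + 2 * j)) T ^ 4"
    using Suc by (intro power_mono) (rule Suc, rule zero_le_power, rule hom_density_nonneg)
  also have "\<dots> \<le> hom_density (cycle_graph (m + 2 * j + 2)) T"
    using m by (intro hom_density_cycle_add_2 T) auto
  finally show ?case by simp
qed simp

subsection \<open>Closed walks with few slopes\<close>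

text \<open>A vertex \<open>a < p * p\<close> stands for the point with coordinates \<open>x = a mod p\<close> and \<open>y = a div p\<close>.\<close>

definition slope :: "nat \<Rightarrow> nat \<Rightarrow> nat \<Rightarrow> nat \<Rightarrow> bool" where
  "slope p s a b \<longleftrightarrow>
     int p dvd int (b div p) - int (a div p) - int s * (int (b mod p) - int (a mod p))"

text \<open>All slopes are finite, so two points with equal x-coordinate satisfy
  \<open>slope\<close> only if they coincide. The condition on \<open>mod\<close> thus removes
  exactly the loops.\<close>

definition slope_graph :: "nat \<Rightarrow> nat \<Rightarrow> nat pair_pre_digraph" where
  "slope_graph p r =
     \<lparr> pverts = {..<p * p},
       parcs = {(a, b). a < p * p \<and> b < p * p \<and> a mod p \<noteq> b mod p \<and> (\<exists>s<r. slope p s a b)} \<rparr>"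

lemma slope_sym: "slope p s a b \<longleftrightarrow> slope p s b a"
proof -
  have "int (a div p) - int (b div p) - int s * (int (a mod p) - int (b mod p)) =
      - (int (b div p) - int (a div p) - int s * (int (b mod p) - int (a mod p)))"
    by (simp add: algebra_simps)
  then show ?thesis unfolding slope_def by (metis dvd_minus_iff)
qed

lemma pair_graph_slope_graph: "pair_graph (slope_graph p r)"
proof
  have "parcs (slope_graph p r) \<subseteq> {..<p * p} \<times> {..<p * p}"
    by (auto simp: slope_graph_def)
  then show "finite (parcs (slope_graph p r))"
    by (rule finite_subset) simp
  have "(b, a) \<in> parcs (slope_graph p r)" if "(a, b) \<in> parcs (slope_graph p r)" for a b
    using that slope_sym by (auto simp: slope_graph_def)
  then show "symmetric (with_proj (slope_graph p r))"
    by (auto simp: symmetric_def sym_def)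
qed (auto simp: slope_graph_def)

section \<open>Differences of two walks with the same slopes\<close>

text \<open>\<open>E\<close> and \<open>D\<close> stand for the differences of the y- and
  x-coordinates of two walks with slopes \<open>s\<close>. While the x-coordinates agree, no step
  changes \<open>E\<close> modulo p.\<close>

lemma telescoping_dvd:
  fixes E D s :: "nat \<Rightarrow> int"
  assumes step: "\<And>i. i < m \<Longrightarrow> p dvd E (Suc i) - E i - s i * (D (Suc i) - D i)"
    and E0: "E 0 = 0" and D: "\<And>i. i \<le> m \<Longrightarrow> D i = 0" and i: "i \<le> m"
  shows "p dvd E i"
  using i
proof (induction i)
  case (Suc i)
  then have "p dvd E i" "p dvd E (Suc i) - E i" using step[of i] D[of i] D[of "Suc i"] by auto
  then show ?case using dvd_add by fastforce
qed (simp add: E0)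

text \<open>Here the walks may differ in x at the single vertex \<open>Suc j\<close>. Entering it
  adds \<open>s j * D (Suc j)\<close> to \<open>E\<close>, leaving it subtracts
  \<open>s (Suc j) * D (Suc j)\<close>, and since the walks close up the total must vanish modulo
  p.\<close>

lemma telescoping_dvd_one_jump:
  fixes E D s :: "nat \<Rightarrow> int"
  assumes step: "\<And>i. i < m \<Longrightarrow> p dvd E (Suc i) - E i - s i * (D (Suc i) - D i)"
    and E: "E 0 = 0" "E m = 0" and j: "Suc j < m"
    and D: "\<And>i. i \<le> m \<Longrightarrow> i \<noteq> Suc j \<Longrightarrow> D i = 0"
  shows "p dvd (s j - s (Suc j)) * D (Suc j)"
proof -
  \<comment> \<open>The conditional is the value of \<open>E i\<close> modulo p before, at and after
    the exceptional vertex. As \<open>Suc j < m\<close>, the index m falls under the last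
    case.\<close>
  have "p dvd E i - (if i \<le> j then 0 else if i = Suc j then s j * D (Suc j)
          else (s j - s (Suc j)) * D (Suc j))" if "i \<le> m" for i
    using that
  proof (induction i)
    case (Suc i)
    let ?v = "\<lambda>i. if i \<le> j then 0 else if i = Suc j then s j * D (Suc j)
          else (s j - s (Suc j)) * D (Suc j)"
    have "?v (Suc i) - ?v i = s i * (D (Suc i) - D i)"
    proof -
      consider "Suc i \<le> j" | "i = j" | "i = Suc j" | "i > Suc j" by linarith
      then show ?thesis
        using Suc.prems D[of i] D[of "Suc i"] by cases (auto simp: algebra_simps)
    qed
    then have "E (Suc i) - ?v (Suc i) =
        (E (Suc i) - E i - s i * (D (Suc i) - D i)) + (E i - ?v i)"
      by linarith
    then show ?case using Suc step[of i] by (metis Suc_leD Suc_le_lessD dvd_add)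
  qed (simp add: E)
  from this[of m] show ?thesis using j E by simp
qed

section \<open>Counting closed walks with prescribed slopes\<close>

text \<open>Consecutive points may coincide, which is harmless because these sets serve only for
  upper bounds.\<close>

definition slope_walks :: "nat \<Rightarrow> nat \<Rightarrow> (nat \<Rightarrow> nat) \<Rightarrow> (nat \<Rightarrow> nat) set" where
  "slope_walks p m s = {f \<in> {..<m} \<rightarrow>\<^sub>E {..<p * p}. \<forall>i<m. slope p (s i) (f i) (f (Suc i mod m))}"

lemma finite_slope_walks: "finite (slope_walks p m s)"
  by (rule finite_subset[of _ "{..<m} \<rightarrow>\<^sub>E {..<p * p}"]) (auto simp: slope_walks_def intro!: finite_PiE)

text \<open>The slope condition is linear in the coordinates, so the difference of two steps of
  equal slope satisfies it too, in the shape the telescoping lemmas expect.\<close>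

lemma slope_diff:
  assumes "slope p s a b" "slope p s a' b'"
  shows "int p dvd (int (b div p) - int (b' div p)) - (int (a div p) - int (a' div p))
     - int s * ((int (b mod p) - int (b' mod p)) - (int (a mod p) - int (a' mod p)))"
proof -
  have "(int (b div p) - int (b' div p)) - (int (a div p) - int (a' div p))
     - int s * ((int (b mod p) - int (b' mod p)) - (int (a mod p) - int (a' mod p))) =
    (int (b div p) - int (a div p) - int s * (int (b mod p) - int (a mod p))) -
    (int (b' div p) - int (a' div p) - int s * (int (b' mod p) - int (a' mod p)))"
    by (simp only: algebra_simps)
  then show ?thesis using assms unfolding slope_def by (metis dvd_diff)
qed

lemma nat_eq_of_dvd_diff:
  assumes "int p dvd int a - int b" "a < p" "b < p"
  shows "a = b"
proof (rule ccontr)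
  assume "a \<noteq> b"
  then have "\<bar>int p\<bar> \<le> \<bar>int a - int b\<bar>" using assms(1) by (intro dvd_imp_le_int) auto
  then show False using assms by linarith
qed

text \<open>Given the slopes and all x-coordinates, the y-coordinate propagates from the first
  vertex along the walk.\<close>

lemma slope_walks_eqI:
  assumes "f \<in> slope_walks p m s" "g \<in> slope_walks p m s" "m > 0"
    and "f 0 div p = g 0 div p" and x: "\<And>i. i < m \<Longrightarrow> f i mod p = g i mod p"
  shows "f = g"
proof (rule PiE_ext)
  show f: "f \<in> {..<m} \<rightarrow>\<^sub>E {..<p * p}" and g: "g \<in> {..<m} \<rightarrow>\<^sub>E {..<p * p}"
    using assms(1,2) by (auto simp: slope_walks_def)
  fix i assume "i \<in> {..<m}"
  then have i: "i < m" by simp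
  \<comment> \<open>Reducing the index modulo m makes index m denote the starting vertex
    again.\<close>
  define E where "E i = int (f (i mod m) div p) - int (g (i mod m) div p)" for i
  define D where "D i = int (f (i mod m) mod p) - int (g (i mod m) mod p)" for i
  have "int p dvd E i"
  proof (rule telescoping_dvd)
    show "int p dvd E (Suc i) - E i - int (s i) * (D (Suc i) - D i)" if "i < m" for i
      using slope_diff[of p "s i" "f i" "f (Suc i mod m)" "g i" "g (Suc i mod m)"] assms(1,2) that
      unfolding E_def D_def slope_walks_def by simp
    show "E 0 = 0" using assms by (simp add: E_def)
    show "D i = 0" if "i \<le> m" for i
      unfolding D_def using x[of "i mod m"] \<open>m > 0\<close> by simp
    show "i \<le> m" using i by simp
  qed
  moreover have "f i < p * p" "g i < p * p" using f g i by auto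
  ultimately have "f i div p = g i div p"
    using i by (intro nat_eq_of_dvd_diff) (auto simp: E_def less_mult_imp_div_less)
  then show "f i = g i" using x[OF i] by (metis div_mult_mod_eq)
qed

text \<open>There are p choices for the first y-coordinate and p^m for the x-coordinates; together
  they determine the walk.\<close>

lemma card_slope_walks_le:
  assumes "m > 0" "p > 0"
  shows "card (slope_walks p m s) \<le> p ^ (m + 1)"
proof -
  let ?h = "\<lambda>f. (f 0 div p, \<lambda>i\<in>{..<m}. f i mod p)"
  have "card (slope_walks p m s) \<le> card ({..<p} \<times> ({..<m} \<rightarrow>\<^sub>E {..<p}))"
  proof (rule card_inj_on_le)
    show "inj_on ?h (slope_walks p m s)"
    proof (rule inj_onI)
      fix f g assume fg: "f \<in> slope_walks p m s" "g \<in> slope_walks p m s" and e: "?h f = ?h g"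
      from e have e1: "f 0 div p = g 0 div p"
        and e2: "(\<lambda>i\<in>{..<m}. f i mod p) = (\<lambda>i\<in>{..<m}. g i mod p)"
        unfolding prod.inject by blast+
      have "f i mod p = g i mod p" if "i < m" for i
        using fun_cong[OF e2, of i] that by simp
      with fg \<open>m > 0\<close> e1 show "f = g" by (rule slope_walks_eqI)
    qed
    show "?h ` slope_walks p m s \<subseteq> {..<p} \<times> ({..<m} \<rightarrow>\<^sub>E {..<p})"
      using assms by (auto simp: slope_walks_def PiE_iff less_mult_imp_div_less split: if_splits)
  qed (auto intro!: finite_PiE)
  also have "\<dots> = p ^ (m + 1)" by (simp add: card_PiE card_cartesian_product)
  finally show ?thesis .
qed

text \<open>At a vertex where the slope changes, the x-coordinate is forced by the remaining data:
  two candidates differ by some D with p dividing (s_j - s_(j+1)) D, and p is prime and does not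
  divide the first factor. This saves one factor p.\<close>

lemma card_slope_walks_le_jump:
  assumes p: "prime p" and j: "Suc j < m" and s: "s j < p" "s (Suc j) < p" "s j \<noteq> s (Suc j)"
  shows "card (slope_walks p m s) \<le> p ^ m"
proof -
  have "p > 0" using p by (simp add: prime_gt_0_nat)
  let ?I = "{..<m} - {Suc j}"
  let ?h = "\<lambda>f. (f 0 div p, \<lambda>i\<in>?I. f i mod p)"
  have "card (slope_walks p m s) \<le> card ({..<p} \<times> (?I \<rightarrow>\<^sub>E {..<p}))"
  proof (rule card_inj_on_le)
    show "inj_on ?h (slope_walks p m s)"
    proof (rule inj_onI)
      fix f g assume fg: "f \<in> slope_walks p m s" "g \<in> slope_walks p m s" and e: "?h f = ?h g"
      from e have e1: "f 0 div p = g 0 div p"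
        and e2: "(\<lambda>i\<in>?I. f i mod p) = (\<lambda>i\<in>?I. g i mod p)"
        unfolding prod.inject by blast+
      have x: "f i mod p = g i mod p" if "i < m" "i \<noteq> Suc j" for i
        using fun_cong[OF e2, of i] that by simp
      define E where "E i = int (f (i mod m) div p) - int (g (i mod m) div p)" for i
      define D where "D i = int (f (i mod m) mod p) - int (g (i mod m) mod p)" for i
      have "int p dvd (int (s j) - int (s (Suc j))) * D (Suc j)"
      proof (rule telescoping_dvd_one_jump)
        show "int p dvd E (Suc i) - E i - int (s i) * (D (Suc i) - D i)" if "i < m" for i
          using slope_diff[of p "s i" "f i" "f (Suc i mod m)" "g i" "g (Suc i mod m)"] fg that
          unfolding E_def D_def slope_walks_def by simp
        show "E 0 = 0" "E m = 0" using e1 by (simp_all add: E_def)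
        \<comment> \<open>Index m wraps around to 0, which is never the exempt index
          \<open>Suc j\<close>.\<close>
        show "D i = 0" if "i \<le> m" "i \<noteq> Suc j" for i
          unfolding D_def using x[of "i mod m"] that j by (cases "i = m") auto
      qed (use j in auto)
      moreover have "\<not> int p dvd int (s j) - int (s (Suc j))"
        using nat_eq_of_dvd_diff s by blast
      ultimately have "int p dvd D (Suc j)"
        using p by (simp add: prime_dvd_mult_iff)
      then have xj: "f (Suc j) mod p = g (Suc j) mod p"
        using j \<open>p > 0\<close> by (intro nat_eq_of_dvd_diff) (auto simp: D_def)
      have "f i mod p = g i mod p" if "i < m" for i
        using x[OF that] xj by (cases "i = Suc j") auto
      moreover have "m > 0" using j by simp
      ultimately show "f = g" using slope_walks_eqI[OF fg] e1 by blast
    qed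
    show "?h ` slope_walks p m s \<subseteq> {..<p} \<times> (?I \<rightarrow>\<^sub>E {..<p})"
      using j \<open>p > 0\<close> by (auto simp: slope_walks_def PiE_iff less_mult_imp_div_less split: if_splits)
  qed (auto intro!: finite_PiE)
  also have "\<dots> = p ^ m" using j by (simp add: card_PiE card_cartesian_product flip: power_Suc)
  finally show ?thesis .
qed

section \<open>Cycle counts in the slope graph\<close>

text \<open>A union bound over slope sequences: the r constant ones contribute at most p^(m+1) each,
  the others, fewer than or equal to r^m in number, at most p^m each. Since r \<le> p, distinct
  slopes stay distinct modulo p.\<close>

lemma hom_count_cycle_slope_graph_le:
  assumes p: "prime p" and r: "r \<le> p" and m: "m > 0"
  shows "hom_count (cycle_graph m) (slope_graph p r) \<le> r * p ^ (m + 1) + r ^ m * p ^ m"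
proof -
  have "p > 0" using p by (simp add: prime_gt_0_nat)
  let ?S = "{..<m} \<rightarrow>\<^sub>E {..<r}"
  define C where "C = (\<lambda>s. \<lambda>i\<in>{..<m}. s) ` {..<r}"
  have finS: "finite ?S" by (intro finite_PiE) auto
  have CS: "C \<subseteq> ?S" by (auto simp: C_def split: if_splits)
  have sub: "graph_homs (cycle_graph m) (slope_graph p r) \<subseteq> (\<Union>s\<in>?S. slope_walks p m s)"
  proof
    fix f assume "f \<in> graph_homs (cycle_graph m) (slope_graph p r)"
    then have "f \<in> {..<m} \<rightarrow>\<^sub>E pverts (slope_graph p r) \<and>
        (\<forall>i<m. (f i, f (Suc i mod m)) \<in> parcs (slope_graph p r))"
      using m by (simp add: cycle_graph_homs_iff[OF pair_graph_slope_graph])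
    then have f: "f \<in> {..<m} \<rightarrow>\<^sub>E {..<p * p}"
      and e: "\<forall>i<m. \<exists>s<r. slope p s (f i) (f (Suc i mod m))"
      by (auto simp: slope_graph_def)
    from e obtain s where s: "\<And>i. i < m \<Longrightarrow> s i < r \<and> slope p (s i) (f i) (f (Suc i mod m))"
      by metis
    then have "restrict s {..<m} \<in> ?S" "f \<in> slope_walks p m (restrict s {..<m})"
      using f by (auto simp: slope_walks_def)
    then show "f \<in> (\<Union>s\<in>?S. slope_walks p m s)" by blast
  qed
  have jump: "card (slope_walks p m s) \<le> p ^ m" if s: "s \<in> ?S - C" for s
  proof -
    \<comment> \<open>Neighbours need not be compared across the wrap-around: if all pairs below m
      agree, induction from 0 makes the sequence constant.\<close>
    have "\<exists>j. Suc j < m \<and> s j \<noteq> s (Suc j)"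
    proof (rule ccontr)
      assume no: "\<not> ?thesis"
      have "s i = s 0" if "i < m" for i
        using that no by (induction i) auto
      then obtain c where c: "\<And>i. i < m \<Longrightarrow> s i = c" by blast
      then have "s = (\<lambda>i\<in>{..<m}. c)" using s by (intro ext) (auto simp: PiE_iff extensional_def)
      moreover have "c < r" using s m c[of 0] by auto
      ultimately have "s \<in> C" unfolding C_def by blast
      then show False using s by blast
    qed
    then obtain j where "Suc j < m" "s j \<noteq> s (Suc j)" by blast
    moreover from this have "s j < r" "s (Suc j) < r" using s by (auto simp: PiE_iff)
    ultimately show ?thesis using p r by (intro card_slope_walks_le_jump) auto
  qed
  have "hom_count (cycle_graph m) (slope_graph p r) \<le> card (\<Union>s\<in>?S. slope_walks p m s)"
    unfolding hom_count_def using finS finite_slope_walks by (intro card_mono sub) auto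
  also have "\<dots> \<le> (\<Sum>s\<in>?S. card (slope_walks p m s))"
    using finS by (rule card_UN_le)
  also have "\<dots> = (\<Sum>s\<in>C. card (slope_walks p m s)) + (\<Sum>s\<in>?S - C. card (slope_walks p m s))"
    using CS finS by (metis add.commute sum.subset_diff)
  also have "(\<Sum>s\<in>C. card (slope_walks p m s)) \<le> card C * p ^ (m + 1)"
    using sum_bounded_above[of C "\<lambda>s. card (slope_walks p m s)" "p ^ (m + 1)"]
      card_slope_walks_le[OF m \<open>p > 0\<close>] by simp
  also have "card C \<le> r" unfolding C_def using card_image_le[of "{..<r}"] by simp
  also have "(\<Sum>s\<in>?S - C. card (slope_walks p m s)) \<le> card (?S - C) * p ^ m"
    using sum_bounded_above[of "?S - C" "\<lambda>s. card (slope_walks p m s)" "p ^ m"] jump by simp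
  also have "card (?S - C) \<le> r ^ m"
    using card_mono[OF finS, of "?S - C"] by (simp add: card_PiE)
  finally show ?thesis by (simp add: add_mono)
qed

text \<open>Any m points with distinct x-coordinates on one line of slope below r are pairwise
  adjacent. Drawing the x-coordinates from m disjoint blocks of length \<open>p div m\<close> keeps
  them distinct, and there are r p such lines.\<close>

lemma hom_count_cycle_slope_graph_ge:
  assumes p: "prime p" and r: "r \<le> p" and m: "2 \<le> m" 
  shows "r * p * (p div m) ^ m \<le> hom_count (cycle_graph m) (slope_graph p r)"
proof -
  have p0: "p > 0" using p by (simp add: prime_gt_0_nat)
  define b where "b = p div m"
  define G where "G = (\<Pi>\<^sub>E i\<in>{..<m}. {i * b..<(i + 1) * b})"
  \<comment> \<open>The line has slope s and intercept y; vertex i is its point with x-coordinate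
    \<open>g i\<close>.\<close>
  let ?h = "\<lambda>(s, y, g). \<lambda>i\<in>{..<m}. ((y + s * g i) mod p) * p + g i"
  have Gp: "g i < p" if "g \<in> G" "i < m" for g i
  proof -
    have "g i < (i + 1) * b" using that by (auto simp: G_def PiE_iff)
    also have "\<dots> \<le> m * b" using that by (intro mult_right_mono) auto
    also have "\<dots> \<le> p" by (simp add: b_def)
    finally show ?thesis .
  qed
  have Gneq: "g i \<noteq> g j" if "g \<in> G" "i < j" "j < m" for g i j
  proof -
    have "g i < (i + 1) * b" "j * b \<le> g j" using that by (auto simp: G_def PiE_iff)
    moreover have "(i + 1) * b \<le> j * b" using that by (intro mult_right_mono) auto
    ultimately show ?thesis by linarith
  qed
  have "r * p * b ^ m = card ({..<r} \<times> {..<p} \<times> G)"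
    by (simp add: G_def card_PiE card_cartesian_product)
  also have "\<dots> \<le> card (graph_homs (cycle_graph m) (slope_graph p r))"
  proof (rule card_inj_on_le)
    show "finite (graph_homs (cycle_graph m) (slope_graph p r))"
      by (rule finite_cycle_graph_homs) (rule pair_graph_slope_graph)
    show "inj_on ?h ({..<r} \<times> {..<p} \<times> G)"
    proof (rule inj_onI)
      fix u v assume uv: "u \<in> {..<r} \<times> {..<p} \<times> G" "v \<in> {..<r} \<times> {..<p} \<times> G" "?h u = ?h v"
      obtain s y g s' y' g' where uv_eq: "u = (s, y, g)" "v = (s', y', g')"
        by (metis prod_cases3)
      have a: "s \<in> {..<r}" "y \<in> {..<p}" "g \<in> G" "s' \<in> {..<r}" "y' \<in> {..<p}" "g' \<in> G"
        using uv(1,2) uv_eq by auto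
      have e: "(\<lambda>i\<in>{..<m}. ((y + s * g i) mod p) * p + g i) =
          (\<lambda>i\<in>{..<m}. ((y' + s' * g' i) mod p) * p + g' i)"
        using uv(3) unfolding uv_eq prod.case .
      have ei: "((y + s * g i) mod p) * p + g i = ((y' + s' * g' i) mod p) * p + g' i" if "i < m" for i
        using fun_cong[OF e, of i] that by simp
      have gg: "g i = g' i" if "i < m" for i
        using arg_cong[OF ei[OF that], of "\<lambda>x. x mod p"] Gp a that by simp
      have "g = g'" using a gg unfolding G_def by (intro PiE_ext[of g]) auto
      have dv: "int p dvd (int y - int y') + (int s - int s') * int (g i)" if "i < m" for i
      proof -
        have "(y + s * g i) mod p = (y' + s' * g i) mod p"
          using ei[OF that] gg[OF that] p0 by simp
        then have "int (y + s * g i) mod int p = int (y' + s' * g i) mod int p"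
          by (metis of_nat_mod)
        then have "int p dvd int (y + s * g i) - int (y' + s' * g i)"
          by (simp add: mod_eq_dvd_iff)
        then show ?thesis by (simp add: algebra_simps)
      qed
      \<comment> \<open>Two points with different x-coordinates determine the line: subtracting the
        congruences at 0 and 1 eliminates the intercepts and isolates the slopes.\<close>
      have "int p dvd ((int y - int y') + (int s - int s') * int (g 0)) -
          ((int y - int y') + (int s - int s') * int (g 1))"
        using dv[of 0] dv[of 1] m by (intro dvd_diff) auto
      then have "int p dvd (int s - int s') * (int (g 0) - int (g 1))"
        by (simp add: algebra_simps)
      moreover have "\<not> int p dvd int (g 0) - int (g 1)"
        using nat_eq_of_dvd_diff[of p "g 0" "g 1"] Gneq[of g 0 1] Gp[of g] a m by force
      ultimately have "int p dvd int s - int s'"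
        using p by (simp add: prime_dvd_mult_iff)
      then have "s = s'" using a r by (intro nat_eq_of_dvd_diff[of p]) auto
      then have "int p dvd int y - int y'" using dv[of 0] m by simp
      then have "y = y'" using a by (intro nat_eq_of_dvd_diff) auto
      show "u = v" unfolding uv_eq using \<open>s = s'\<close> \<open>y = y'\<close> \<open>g = g'\<close> by simp
    qed
    show "?h ` ({..<r} \<times> {..<p} \<times> G) \<subseteq> graph_homs (cycle_graph m) (slope_graph p r)"
    proof (rule image_subsetI)
      fix u assume u: "u \<in> {..<r} \<times> {..<p} \<times> G"
      obtain s y g where u_eq: "u = (s, y, g)" by (metis prod_cases3)
      have a: "s \<in> {..<r}" "y \<in> {..<p}" "g \<in> G" using u u_eq by auto
      define f where "f = (\<lambda>i\<in>{..<m}. ((y + s * g i) mod p) * p + g i)"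
      have fm: "f i mod p = g i" "f i div p = (y + s * g i) mod p" "f i < p * p" if "i < m" for i
      proof -
        have f: "f i = ((y + s * g i) mod p) * p + g i" using that by (simp add: f_def)
        have g: "g i < p" using Gp a that by simp
        show "f i mod p = g i" "f i div p = (y + s * g i) mod p" unfolding f using g p0 by simp_all
        have "(y + s * g i) mod p + 1 \<le> p" using p0 by (simp add: Suc_leI)
        then have "((y + s * g i) mod p + 1) * p \<le> p * p" by (rule mult_right_mono) simp
        then show "f i < p * p" unfolding f using g by simp
      qed
      have sl: "slope p s (f i) (f j)" if "i < m" "j < m" for i j
      proof -
        have "int p dvd int ((y + s * g j) mod p) - int (y + s * g j)"
          "int p dvd int ((y + s * g i) mod p) - int (y + s * g i)"
          by (metis mod_eq_dvd_iff mod_mod_trivial of_nat_mod)+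
        then have "int p dvd (int ((y + s * g j) mod p) - int (y + s * g j)) -
            (int ((y + s * g i) mod p) - int (y + s * g i))" by (rule dvd_diff)
        moreover have "(int ((y + s * g j) mod p) - int (y + s * g j)) -
            (int ((y + s * g i) mod p) - int (y + s * g i)) =
            int ((y + s * g j) mod p) - int ((y + s * g i) mod p) - int s * (int (g j) - int (g i))"
          by (simp add: algebra_simps)
        ultimately show ?thesis unfolding slope_def using fm that by metis
      qed
      have "(f i, f (Suc i mod m)) \<in> parcs (slope_graph p r)" if i: "i < m" for i
      proof -
        have i': "Suc i mod m < m" using m by simp
        have "i \<noteq> Suc i mod m" using i m by (cases "Suc i = m") auto
        then have "g i \<noteq> g (Suc i mod m)"
          using Gneq[of g i "Suc i mod m"] Gneq[of g "Suc i mod m" i] a i i' by (metis nat_neq_iff)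
        then show ?thesis using fm[OF i] fm[OF i'] sl[OF i i'] a by (auto simp: slope_graph_def)
      qed
      moreover have "f \<in> {..<m} \<rightarrow>\<^sub>E {..<p * p}" using fm(3) by (auto simp: f_def)
      ultimately have "f \<in> graph_homs (cycle_graph m) (slope_graph p r)"
        using m by (subst cycle_graph_homs_iff[OF pair_graph_slope_graph]) (auto simp: slope_graph_def)
      then show "?h u \<in> graph_homs (cycle_graph m) (slope_graph p r)"
        unfolding u_eq prod.case f_def .
    qed
  qed
  finally show ?thesis by (simp add: hom_count_def b_def)
qed

subsection \<open>The lower bound\<close>

text \<open>With r the integer part of p^(1/(2k)), r^(2k) \<le> p holds, so for the longer cycle the
  second term of the count is at most the first; hence the factor 2. In the lower bound, 1/2 pays
  for rounding r, and each of the m factors 1/(2m) for \<open>p div m\<close> in place of p.\<close>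

lemma slope_graph_densities:
  fixes k l p :: nat
  assumes p: "prime p" "2 * l + 1 \<le> p" and k: "k \<ge> 1" and l: "l \<ge> 1"
  defines "m \<equiv> 2 * l + 1"
  obtains T :: "nat pair_pre_digraph" where "pair_graph T" "pverts T \<noteq> {}"
    "(1 / (2 * real m)) ^ m / 2 * real p powr (1 / (2 * real k) - 2 * real l)
      \<le> hom_density (cycle_graph (2 * l + 1)) T"
    "hom_density (cycle_graph (2 * k + 1)) T \<le> 2 * real p powr (1 / (2 * real k) - 2 * real k)"
proof -
  have p1: "real p > 1" using p(1) prime_gt_1_nat by auto
  define \<alpha> where "\<alpha> = 1 / (2 * real k)"
  define \<rho> where "\<rho> = real p powr \<alpha>"
  define r where "r = nat \<lfloor>\<rho>\<rfloor>"
  have \<alpha>: "0 < \<alpha>" "\<alpha> \<le> 1" using k by (auto simp: \<alpha>_def divide_le_eq)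
  have \<rho>1: "\<rho> \<ge> 1" using p1 \<alpha> by (simp add: \<rho>_def ge_one_powr_ge_zero)
  have r_le: "real r \<le> \<rho>" and r_ge: "\<rho> / 2 \<le> real r"
  proof -
    have "\<lfloor>\<rho>\<rfloor> \<ge> 1" using \<rho>1 by simp
    then have "real r = real_of_int \<lfloor>\<rho>\<rfloor>" "real_of_int \<lfloor>\<rho>\<rfloor> \<ge> 1" by (simp_all add: r_def)
    then show "real r \<le> \<rho>" "\<rho> / 2 \<le> real r" by linarith+
  qed
  have "\<rho> \<le> real p powr 1" unfolding \<rho>_def using p1 \<alpha> by (intro powr_mono) auto
  then have rp: "r \<le> p" using r_le p1 by simp
  have "real r ^ (2 * k) \<le> \<rho> ^ (2 * k)" using r_le by (intro power_mono) auto
  also have "\<dots> = \<rho> powr (2 * real k)" using \<rho>1 by (simp flip: powr_realpow)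
  also have "\<dots> = real p" using p1 k by (simp add: \<rho>_def powr_powr \<alpha>_def)
  finally have rk: "real r ^ (2 * k) \<le> real p" .
  let ?T = "slope_graph p r"
  have card: "card (pverts ?T) = p * p" by (simp add: slope_graph_def)
  have powp: "real p powr (\<alpha> - 2 * real j) = \<rho> / real p ^ (2 * j)" for j
    using p1 by (simp add: \<rho>_def powr_diff flip: powr_realpow)
  \<comment> \<open>The graph has p^2 vertices; its power is split so that
    \<open>p ^ (2 * j + 2)\<close> cancels against the counts.\<close>
  have pp: "real p ^ (2 * j + 1) * real p ^ (2 * j + 1) = real p ^ (2 * j + 2) * real p ^ (2 * j)" for j
    by (simp flip: power_add add: algebra_simps)
  have dens: "hom_density (cycle_graph (2 * j + 1)) ?T =
      real (hom_count (cycle_graph (2 * j + 1)) ?T) / (real p ^ (2 * j + 2) * real p ^ (2 * j))" for j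
    unfolding hom_density_def card pp[symmetric] by (simp add: cycle_graph_def power_mult_distrib)
  have up: "hom_density (cycle_graph (2 * k + 1)) ?T \<le> 2 * real p powr (\<alpha> - 2 * real k)"
  proof -
    have "real (hom_count (cycle_graph (2 * k + 1)) ?T) \<le>
        real (r * p ^ (2 * k + 1 + 1) + r ^ (2 * k + 1) * p ^ (2 * k + 1))"
      using hom_count_cycle_slope_graph_le[OF p(1) rp, of "2 * k + 1"] by (subst of_nat_le_iff) simp
    also have "\<dots> = real r * real p ^ (2 * k + 2) + real r * real r ^ (2 * k) * real p ^ (2 * k + 1)"
      by simp
    also have "\<dots> \<le> real r * real p ^ (2 * k + 2) + real r * real p * real p ^ (2 * k + 1)"
      using rk by (intro add_mono mult_right_mono mult_left_mono) auto
    also have "\<dots> = 2 * real r * real p ^ (2 * k + 2)" by simp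
    also have "\<dots> \<le> 2 * \<rho> * real p ^ (2 * k + 2)" using r_le by (intro mult_right_mono) auto
    finally have "real (hom_count (cycle_graph (2 * k + 1)) ?T) \<le> 2 * \<rho> * real p ^ (2 * k + 2)" .
    then have "hom_density (cycle_graph (2 * k + 1)) ?T \<le>
        2 * \<rho> * real p ^ (2 * k + 2) / (real p ^ (2 * k + 2) * real p ^ (2 * k))"
      unfolding dens by (intro divide_right_mono) auto
    also have "\<dots> = 2 * real p powr (\<alpha> - 2 * real k)" using p1 powp[of k] by simp
    finally show ?thesis .
  qed
  have low: "(1 / (2 * real m)) ^ m / 2 * real p powr (\<alpha> - 2 * real l)
      \<le> hom_density (cycle_graph (2 * l + 1)) ?T"
  proof -
    have m: "m \<ge> 2" "m \<le> p" using p l by (auto simp: m_def)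
    have "p < m * (p div m) + m"
      using m by (metis add.commute add_less_cancel_left div_mult_mod_eq mod_less_divisor
          mult.commute order_less_le_trans pos2)
    \<comment> \<open>As m \<le> p, the quotient is at least 1, so the remainder bound m is absorbed
      by a second copy of \<open>m * (p div m)\<close>.\<close>
    also have "\<dots> \<le> m * (p div m) + m * (p div m)"
      using m by (simp add: div_greater_zero_iff Suc_le_eq)
    finally have "p \<le> 2 * m * (p div m)" by simp
    then have "real p \<le> real (2 * m * (p div m))" by (subst of_nat_le_iff)
    then have "real p \<le> 2 * real m * real (p div m)" by simp
    then have "real p / (2 * real m) \<le> real (p div m)" using m by (simp add: divide_le_eq mult.commute)
    then have "(real p / (2 * real m)) ^ m \<le> real (p div m) ^ m" by (intro power_mono) auto
    then have "\<rho> / 2 * real p * (real p / (2 * real m)) ^ m \<le> real r * real p * real (p div m) ^ m"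
      using r_ge \<rho>1 by (intro mult_mono) auto
    also have "\<dots> \<le> real (hom_count (cycle_graph m) ?T)"
      using hom_count_cycle_slope_graph_ge[OF p(1) rp m(1)]
      by (metis of_nat_le_iff of_nat_mult of_nat_power)
    finally have "\<rho> / 2 * real p * (real p / (2 * real m)) ^ m / (real p ^ (2 * l + 2) * real p ^ (2 * l))
        \<le> hom_density (cycle_graph (2 * l + 1)) ?T"
      unfolding dens m_def by (intro divide_right_mono) auto
    moreover have "real p * (real p / (2 * real m)) ^ m = (1 / (2 * real m)) ^ m * real p ^ (2 * l + 2)"
      by (simp add: m_def power_divide)
    then have "\<rho> / 2 * real p * (real p / (2 * real m)) ^ m / (real p ^ (2 * l + 2) * real p ^ (2 * l)) =
        (1 / (2 * real m)) ^ m / 2 * real p powr (\<alpha> - 2 * real l)"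
      using p1 powp[of l] by (simp add: mult.assoc)
    ultimately show ?thesis by simp
  qed
  show ?thesis
    by (rule that[OF pair_graph_slope_graph _ low[unfolded \<alpha>_def] up[unfolded \<alpha>_def]])
      (use p1 in \<open>auto simp: slope_graph_def lessThan_empty_iff\<close>)
qed

section \<open>Letting p grow\<close>

text \<open>Logarithms of the density bounds give an inequality linear in ln p. Comparing leading
  coefficients over arbitrarily large primes yields 2k - \<alpha> \<le> c (2l - \<alpha>), and
  multiplying by 2k = 1/\<alpha> gives the stated quotient.\<close>

lemma admissible_exponent_ge:
  fixes k l :: nat and c :: real
  assumes l: "1 \<le> l" and k: "1 \<le> k"
    and c: "\<And>T :: nat pair_pre_digraph. pair_graph T \<Longrightarrow> pverts T \<noteq> {} \<Longrightarrow>
      hom_density (cycle_graph (2 * k + 1)) T \<ge> hom_density (cycle_graph (2 * l + 1)) T powr c"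
  shows "(4 * real k ^ 2 - 1) / (4 * real k * real l - 1) \<le> c"
proof -
  define \<alpha> where "\<alpha> = 1 / (2 * real k)"
  define \<kappa> where "\<kappa> = (1 / (2 * real (2 * l + 1))) ^ (2 * l + 1) / 2"
  have \<alpha>: "0 < \<alpha>" "\<alpha> \<le> 1" using k by (auto simp: \<alpha>_def divide_le_eq)
  have \<kappa>: "\<kappa> > 0" unfolding \<kappa>_def by (intro divide_pos_pos zero_less_power) auto
  have large: "0 \<le> c \<and> c * (ln \<kappa> + (\<alpha> - 2 * l) * ln p) \<le> ln 2 + (\<alpha> - 2 * k) * ln p"
    if p: "prime p" "2 * l + 1 \<le> p" for p :: nat
  proof -
    obtain T :: "nat pair_pre_digraph" where T: "pair_graph T" "pverts T \<noteq> {}"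
      and low: "\<kappa> * real p powr (\<alpha> - 2 * real l) \<le> hom_density (cycle_graph (2 * l + 1)) T"
      and up: "hom_density (cycle_graph (2 * k + 1)) T \<le> 2 * real p powr (\<alpha> - 2 * real k)"
      unfolding \<alpha>_def \<kappa>_def by (rule slope_graph_densities[OF p k l])
    have p3: "real p \<ge> 3" using p l by simp
    let ?t = "hom_density (cycle_graph (2 * l + 1)) T"
    have pos: "0 < \<kappa> * real p powr (\<alpha> - 2 * real l)" using \<kappa> p3 by simp
    have le: "?t powr c \<le> 2 * real p powr (\<alpha> - 2 * real k)" using c[OF T] up by linarith
    \<comment> \<open>Monotonicity of \<open>powr\<close> in its base, used below, requires c \<ge>
      0. For negative c a base in (0, 1] would give a power of at least 1, against the upper bound
      2/p < 1.\<close>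
    have "c \<ge> 0"
    proof (rule ccontr)
      assume "\<not> 0 \<le> c"
      then have "?t powr 0 \<le> ?t powr c"
        using pos low hom_density_cycle_le_1[OF T(1), of "2 * l + 1"] by (intro powr_mono') auto
      then have "1 \<le> ?t powr c" using pos low by simp
      also note le
      also have "2 * real p powr (\<alpha> - 2 * real k) \<le> 2 * real p powr (- 1)"
        using p3 \<alpha> k by (intro mult_left_mono powr_mono) auto
      also have "\<dots> = 2 / real p" using p3 by (simp add: powr_minus_divide)
      finally show False using p3 by (simp add: divide_simps)
    qed
    moreover have "(\<kappa> * real p powr (\<alpha> - 2 * real l)) powr c \<le> 2 * real p powr (\<alpha> - 2 * real k)"
      using le powr_mono2[OF \<open>c \<ge> 0\<close> _ low] pos by linarith
    then have "ln ((\<kappa> * real p powr (\<alpha> - 2 * real l)) powr c) \<le> ln (2 * real p powr (\<alpha> - 2 * real k))"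
      using pos p3 by (subst ln_le_cancel_iff) auto
    then have "c * (ln \<kappa> + (\<alpha> - 2 * l) * ln p) \<le> ln 2 + (\<alpha> - 2 * k) * ln p"
      using \<kappa> p3 by (simp add: ln_powr ln_mult)
    ultimately show ?thesis by blast
  qed
  \<comment> \<open>The inequality rearranges to \<delta> ln p \<le> ln 2 - c ln \<kappa>, whose
    right side is independent of p. A positive \<delta> would therefore bound all large primes by
    exp B.\<close>
  define \<delta> where "\<delta> = (2 * k - \<alpha>) - c * (2 * l - \<alpha>)"
  have "\<delta> \<le> 0"
  proof (rule ccontr)
    assume "\<not> \<delta> \<le> 0"
    define B where "B = (ln 2 - c * ln \<kappa>) / \<delta>"
    obtain p where p: "prime p" "p > max (2 * l + 1) (nat \<lceil>exp (B + 1)\<rceil>)"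
      using bigger_prime by blast
    have "exp (B + 1) \<le> real p" using p(2) by linarith
    then have "B + 1 \<le> ln p" by (metis exp_gt_zero ln_exp ln_le_cancel_iff order_less_le_trans)
    moreover have "\<delta> * ln p \<le> ln 2 - c * ln \<kappa>"
      using large[OF p(1)] p(2) by (simp add: \<delta>_def algebra_simps)
    then have "ln p \<le> B" using \<open>\<not> \<delta> \<le> 0\<close> by (simp add: B_def le_divide_eq mult.commute)
    ultimately show False by simp
  qed
  have kl: "4 * real k * real l - 1 > 0"
    using mult_mono[of 1 "real k" 1 "real l"] k l by simp
  have "2 * real k * \<delta> = (4 * real k ^ 2 - 1) - c * (4 * real k * real l - 1)"
    using k by (simp add: \<delta>_def \<alpha>_def field_simps power2_eq_square)
  then have "4 * real k ^ 2 - 1 \<le> c * (4 * real k * real l - 1)"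
    using \<open>\<delta> \<le> 0\<close> by (smt (verit) mult_nonneg_nonpos of_nat_0_le_iff)
  then show ?thesis using kl by (simp add: divide_le_eq)
qed

section \<open>Attainment of the minimum\<close>

theorem theorem4p7:
  fixes k l :: nat
  assumes "1 \<le> l" and "l \<le> k"
  shows "domination_exponent (cycle_graph (2 * k + 1)) (cycle_graph (2 * l + 1))
           \<ge> (4 * real k ^ 2 - 1) / (4 * real k * real l - 1)"
proof -
  let ?G = "cycle_graph (2 * k + 1)" and ?H = "cycle_graph (2 * l + 1)"
  let ?b = "(4 * real k ^ 2 - 1) / (4 * real k * real l - 1)"
  define A where "A = {c. \<forall>T :: nat pair_pre_digraph. pair_graph T \<and> pverts T \<noteq> {} \<longrightarrow>
        hom_density ?G T \<ge> hom_density ?H T powr c}"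
  have lower: "?b \<le> c" if "c \<in> A" for c
  proof (rule admissible_exponent_ge)
    show "1 \<le> l" "1 \<le> k" using assms by auto
    show "hom_density ?H T powr c \<le> hom_density ?G T"
      if "pair_graph T" "pverts T \<noteq> {}" for T :: "nat pair_pre_digraph"
      using \<open>c \<in> A\<close> that unfolding A_def by blast
  qed
  have "4 ^ (k - l) \<in> A"
  proof -
    have "hom_density ?H T powr (4 ^ (k - l)) \<le> hom_density ?G T"
      if T: "pair_graph T" "pverts T \<noteq> {}" for T :: "nat pair_pre_digraph"
    proof (cases "hom_density ?H T = 0")
      case False
      then have "hom_density ?H T > 0" using hom_density_nonneg[of ?H T] by linarith
      then have "hom_density ?H T powr (4 ^ (k - l)) = hom_density ?H T ^ (4 ^ (k - l))"
        using powr_realpow[of "hom_density ?H T" "4 ^ (k - l)"] by simp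
      also have "\<dots> \<le> hom_density (cycle_graph (2 * l + 1 + 2 * (k - l))) T"
        using assms by (intro hom_density_cycle_add T) auto
      also have "2 * l + 1 + 2 * (k - l) = 2 * k + 1" using assms by simp
      finally show ?thesis .
    qed (simp add: hom_density_nonneg)
    then show ?thesis unfolding A_def by blast
  qed
  then have "A \<noteq> {}" by blast
  have "closed A"
  proof -
    \<comment> \<open>For base 0 the power is 0 for every c, so the set is all of the reals; for any
      other base the power is continuous in c.\<close>
    have "closed {c. hom_density ?H T powr c \<le> hom_density ?G T}" for T :: "nat pair_pre_digraph"
    proof (cases "hom_density ?H T = 0")
      case True
      then show ?thesis by (simp add: hom_density_nonneg)
    next
      case False
      then show ?thesis by (intro closed_Collect_le continuous_intros) auto
    qed
    then have "closed (\<Inter>T\<in>{T :: nat pair_pre_digraph. pair_graph T \<and> pverts T \<noteq> {}}.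
        {c. hom_density ?H T powr c \<le> hom_density ?G T})"
      by blast
    also have "\<dots> = A" by (auto simp: A_def)
    finally show ?thesis .
  qed
  have bdd: "bdd_below A" using lower by (auto simp: bdd_below_def)
  \<comment> \<open>The infimum is itself admissible, so \<open>LEAST\<close> denotes it and the
    bound for admissible exponents applies to it.\<close>
  have "Inf A \<in> A" using \<open>A \<noteq> {}\<close> bdd \<open>closed A\<close> by (rule closed_contains_Inf)
  moreover have "Inf A \<le> c" if "c \<in> A" for c using that bdd by (rule cInf_lower)
  ultimately have "(LEAST c. c \<in> A) = Inf A" by (intro Least_equality)
  then have "domination_exponent ?G ?H = Inf A"
    unfolding domination_exponent_def A_def mem_Collect_eq .
  then show ?thesis using lower[OF \<open>Inf A \<in> A\<close>] by simp
qed

end
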